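(* Let $A\in\mathbb{R}^{n\times n}$ be stable. Then the optimization problem of minimizing $g(p) = \operatorname{tr}\left(W_{\rm con}(p)^{-1}\right)$ subject to $p\in\mathcal{F} = X\cap\Delta$ has a unique optimal solution; that is, there exists exactly one $p^*\in\mathcal{F}$ such that $g(p^* )\le g(p)$ for all $p\in\mathcal{F}$.
   Context: A real square matrix $A$ is called stable if all of its eigenvalues have negative real part. For stable $A\in\mathbb{R}^{n\times n}$ and $i=1,\dots,n$ put $W_i := \int_0^\infty \exp(At)\, e_i e_i^\top \exp(A^\top t)\, dt$, where $e_i\in\mathbb{R}^n$ is the $i$-th standard basis vector. For $p=(p_1,\dots,p_n)\in\mathbb{R}^n$ put $W_{\rm con}(p) := \sum_{i=1}^n p_i W_i$. Let $X := \{p\in\mathbb{R}^n \mid W_{\rm con}(p)\succ O\}$ (positive definite), $\Delta := \{p\in\mathbb{R}^n \mid \sum_{i=1}^n p_i = 1,\ p_i\ge 0 \ (i=1,\dots,n)\}$, and $\mathcal{F} := X\cap\Delta$. The function $g$ is defined on $X$ by $g(p) := \operatorname{tr}(W_{\rm con}(p)^{-1})$. *)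

theory Defs
  imports "HOL-Analysis.Analysis"
begin

definition eigenvalue :: "complex^'n^'n \<Rightarrow> complex \<Rightarrow> bool" where
  "eigenvalue M l \<longleftrightarrow> (\<exists>v. v \<noteq> 0 \<and> M *v v = l *s v)"

text \<open>The eigenvalues of a real matrix are taken over the complex numbers.\<close>

definition stable_matrix :: "real^'n^'n \<Rightarrow> bool" where
  "stable_matrix A \<longleftrightarrow>
     (\<forall>l. eigenvalue (map_matrix complex_of_real A) l \<longrightarrow> Re l < 0)"

text \<open>On the type of matrices, \<open>*\<close> and \<open>^\<close> are componentwise, and the library function
  \<open>exp\<close> is not available. Matrix powers and the matrix exponential are therefore defined
  here from the matrix product \<open>**\<close>.\<close>

primrec matrix_power :: "real^'n^'n \<Rightarrow> nat \<Rightarrow> real^'n^'n" where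
  "matrix_power M 0 = mat 1"
| "matrix_power M (Suc k) = M ** matrix_power M k"

definition matrix_exp :: "real^'n^'n \<Rightarrow> real^'n^'n" where
  "matrix_exp M = (\<Sum>k. (1 / fact k) *\<^sub>R matrix_power M k)"

definition pos_def_matrix :: "real^'n^'n \<Rightarrow> bool" where
  "pos_def_matrix M \<longleftrightarrow> transpose M = M \<and> (\<forall>x. x \<noteq> 0 \<longrightarrow> x \<bullet> (M *v x) > 0)"

definition gramian :: "real^'n^'n \<Rightarrow> 'n \<Rightarrow> real^'n^'n" where
  "gramian A i = integral {0..} (\<lambda>t::real.
     matrix_exp (t *\<^sub>R A)
       ** ((columnvector (axis i 1) :: real^1^'n) ** (rowvector (axis i 1) :: real^'n^1))
       ** matrix_exp (t *\<^sub>R transpose A))"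

definition W_con :: "real^'n^'n \<Rightarrow> real^'n \<Rightarrow> real^'n^'n" where
  "W_con A p = (\<Sum>i\<in>UNIV. p $ i *\<^sub>R gramian A i)"

definition pd_region :: "real^'n^'n \<Rightarrow> (real^'n) set" where
  "pd_region A = {p. pos_def_matrix (W_con A p)}"

definition prob_simplex :: "(real^'n) set" where
  "prob_simplex = {p. (\<Sum>i\<in>UNIV. p $ i) = 1 \<and> (\<forall>i. p $ i \<ge> 0)}"

definition feasible :: "real^'n^'n \<Rightarrow> (real^'n) set" where
  "feasible A = pd_region A \<inter> prob_simplex"

text \<open>Only meaningful for \<open>p\<close> in \<open>pd_region A\<close>, where \<open>W_con A p\<close> is invertible.\<close>

definition objective :: "real^'n^'n \<Rightarrow> real^'n \<Rightarrow> real" where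
  "objective A p = trace (matrix_inv (W_con A p))"

end

theory Submission
  imports Defs "HOL-Computational_Algebra.Fundamental_Theorem_Algebra" "HOL-Real_Asymp.Real_Asymp"
begin

text \<open>Proof idea. Every complex vector \<open>v\<close> is annihilated by some nonzero polynomial in \<open>A\<close>; splitting off
  linear factors one at a time (those at non-eigenvalues can be cancelled, those at eigenvalues \<open>l\<close>
  have \<open>Re l < 0\<close>) shows that \<open>exp (t A) v\<close> decays exponentially, so the Gramians are convergent integrals.
  Integrating the derivative of \<open>exp (t A) diag p exp (t A\<^sup>T)\<close> shows that \<open>p\<close> is determined by \<open>W_con A p\<close>.
  The trace of the inverse is the maximum over \<open>Y\<close> of the functionals
  \<open>\<Sum>\<^sub>j 2 e\<^sub>j \<bullet> Y\<^sub>j - Y\<^sub>j \<bullet> W Y\<^sub>j\<close>, which are affine in \<open>W\<close> and whose maximizer determines \<open>W\<close>: this makes the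
  objective strictly midpoint convex, whence uniqueness, and lower semicontinuous with value \<open>\<infinity>\<close>
  outside the feasible part of the compact simplex, whence existence.\<close>

section \<open>The matrix exponential as a power series\<close>

text \<open>Each further factor \<open>A\<close> sums \<open>CARD('n)\<close> products whose first
  factor is at most \<open>norm A\<close>. The bound is crude, but geometric growth is all that a
  comparison with the exponential series needs.\<close>

lemma matrix_power_entry_le:
  fixes A :: "real^'n^'n"
  shows "\<bar>matrix_power A k $ i $ j\<bar> \<le> (real CARD('n) * norm A) ^ k"
proof (induction k arbitrary: i)
  case 0
  then show ?case by (simp add: mat_def)
next
  case (Suc k)
  have entry: "\<bar>A $ i $ m\<bar> \<le> norm A" for m
    by (rule order_trans[OF component_le_norm_cart Finite_Cartesian_Product.norm_nth_le])
  have "\<bar>matrix_power A (Suc k) $ i $ j\<bar> = \<bar>\<Sum>m\<in>UNIV. A $ i $ m * matrix_power A k $ m $ j\<bar>"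
    by (simp add: matrix_matrix_mult_def)
  also have "\<dots> \<le> (\<Sum>m\<in>(UNIV::'n set). norm A * (real CARD('n) * norm A) ^ k)"
    by (rule order_trans[OF sum_abs sum_mono]) (auto simp: abs_mult intro!: mult_mono entry Suc)
  finally show ?case by simp
qed

lemma matrix_power_scaleR: "matrix_power (t *\<^sub>R A) k = t ^ k *\<^sub>R matrix_power A k"
  by (induction k) (simp_all add: matrix_scalar_ac scalar_matrix_assoc power_commutes[symmetric])

lemma matrix_power_commute: "A ** matrix_power A k = matrix_power A k ** A"
  by (induction k) (simp_all add: matrix_mul_assoc)

lemma transpose_matrix_power: "transpose (matrix_power A k) = matrix_power (transpose A) k"
  by (induction k) (simp_all add: matrix_transpose_mul flip: matrix_power_commute)

lemma sums_matrixI: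
  fixes f :: "nat \<Rightarrow> real^'n^'m"
  assumes "\<And>i j. (\<lambda>k. f k $ i $ j) sums (L $ i $ j)"
  shows "f sums L"
  using assms unfolding sums_def
  by (intro vec_tendstoI) (simp add: sum_component)

lemma matrix_power_series_summable:
  fixes A :: "real^'n^'n"
  shows "summable (\<lambda>k. matrix_power A k $ i $ j / fact k * t ^ k)"
proof (rule summable_comparison_test')
  show "summable (\<lambda>k. inverse (fact k) * (real CARD('n) * norm A * \<bar>t\<bar>) ^ k)"
    by (rule summable_exp)
  show "norm (matrix_power A k $ i $ j / fact k * t ^ k)
      \<le> inverse (fact k) * (real CARD('n) * norm A * \<bar>t\<bar>) ^ k" for k
    using mult_right_mono[OF matrix_power_entry_le[of A k i j], of "\<bar>t\<bar> ^ k / fact k"]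
    by (simp add: abs_mult power_abs power_mult_distrib field_simps)
qed

text \<open>With \<open>t\<close> pulled out of the matrix powers, every entry is a real power
  series in \<open>t\<close> whose coefficients do not depend on \<open>t\<close>. Transposition,
  commutation and the derivative then follow from uniqueness of sums.\<close>

lemma matrix_exp_entry_sums:
  fixes A :: "real^'n^'n"
  shows "(\<lambda>k. matrix_power A k $ i $ j / fact k * t ^ k) sums (matrix_exp (t *\<^sub>R A) $ i $ j)"
proof -
  let ?L = "(\<chi> i j. \<Sum>k. matrix_power A k $ i $ j / fact k * t ^ k) :: real^'n^'n"
  have "(\<lambda>k. (1 / fact k) *\<^sub>R matrix_power (t *\<^sub>R A) k) sums ?L"
    using matrix_power_series_summable[of A _ _ t, THEN summable_sums]
    by (intro sums_matrixI) (simp add: matrix_power_scaleR mult_ac)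
  then have "matrix_exp (t *\<^sub>R A) = ?L"
    unfolding matrix_exp_def by (rule sums_unique[symmetric])
  then show ?thesis
    using matrix_power_series_summable[of A i j t, THEN summable_sums] by simp
qed

lemma matrix_exp_transpose: "matrix_exp (t *\<^sub>R transpose A) = transpose (matrix_exp (t *\<^sub>R A))"
proof -
  have "matrix_exp (t *\<^sub>R transpose A) $ i $ j = matrix_exp (t *\<^sub>R A) $ j $ i" for i j
    using matrix_exp_entry_sums[of "transpose A" i j t] matrix_exp_entry_sums[of A j i t]
    by (simp add: flip: transpose_matrix_power) (simp add: transpose_def sums_unique2)
  then show ?thesis by (simp add: vec_eq_iff transpose_def)
qed

text \<open>This is the derivative series: differentiating
  \<open>a (Suc k) / fact (Suc k) * t ^ Suc k\<close> leaves
  \<open>a (Suc k) / fact k * t ^ k\<close>, where the extra power is a left factor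
  \<open>A\<close>.\<close>

lemma matrix_exp_mult_entry_sums:
  "(\<lambda>k. matrix_power A (Suc k) $ i $ j / fact k * t ^ k) sums ((A ** matrix_exp (t *\<^sub>R A)) $ i $ j)"
proof -
  have "(\<lambda>k. \<Sum>m\<in>UNIV. A $ i $ m * (matrix_power A k $ m $ j / fact k * t ^ k))
      sums (\<Sum>m\<in>UNIV. A $ i $ m * matrix_exp (t *\<^sub>R A) $ m $ j)"
    by (intro sums_sum sums_mult matrix_exp_entry_sums)
  then show ?thesis
    by (simp add: matrix_matrix_mult_def sum_distrib_left sum_divide_distrib mult_ac)
qed

lemma matrix_exp_commute: "A ** matrix_exp (t *\<^sub>R A) = matrix_exp (t *\<^sub>R A) ** A"
proof -
  have "(\<lambda>k. \<Sum>m\<in>UNIV. (matrix_power A k $ i $ m / fact k * t ^ k) * A $ m $ j)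
      sums (\<Sum>m\<in>UNIV. matrix_exp (t *\<^sub>R A) $ i $ m * A $ m $ j)" for i j
    by (intro sums_sum sums_mult2 matrix_exp_entry_sums)
  then have "(\<lambda>k. matrix_power A (Suc k) $ i $ j / fact k * t ^ k)
      sums ((matrix_exp (t *\<^sub>R A) ** A) $ i $ j)" for i j
    unfolding matrix_power.simps matrix_power_commute
    by (simp add: matrix_matrix_mult_def sum_distrib_left sum_divide_distrib mult_ac)
  then show ?thesis
    unfolding vec_eq_iff by (intro allI sums_unique2[OF matrix_exp_mult_entry_sums])
qed

lemma matrix_exp_entry_deriv:
  "((\<lambda>t. matrix_exp (t *\<^sub>R A) $ i $ j) has_real_derivative
     (A ** matrix_exp (t *\<^sub>R A)) $ i $ j) (at t)"
proof -
  let ?c = "\<lambda>k. matrix_power A k $ i $ j / fact k"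
  have "((\<lambda>x. \<Sum>n. ?c n * x ^ n) has_real_derivative (\<Sum>n. diffs ?c n * t ^ n)) (at t)"
    by (rule termdiffs_strong_converges_everywhere) (rule matrix_power_series_summable)
  moreover have "diffs ?c = (\<lambda>k. matrix_power A (Suc k) $ i $ j / fact k)"
    unfolding diffs_def by (rule ext) (simp add: field_simps del: of_nat_Suc matrix_power.simps)
  moreover have "(\<lambda>x. \<Sum>n. ?c n * x ^ n) = (\<lambda>x. matrix_exp (x *\<^sub>R A) $ i $ j)"
    using sums_unique[OF matrix_exp_entry_sums[of A i j]] by (intro ext) simp
  ultimately show ?thesis
    using sums_unique[OF matrix_exp_mult_entry_sums[of A i j t]] by (simp del: matrix_power.simps)
qed

lemma matrix_exp_zero: "matrix_exp (0 :: real^'n^'n) = mat 1"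
proof -
  have "(\<lambda>k. matrix_power 0 k $ i $ j / fact k * 0 ^ k) sums (mat 1 $ i $ j)" for i j :: 'n
    using powser_sums_zero[of "\<lambda>k. matrix_power 0 k $ i $ j / fact k"] by simp
  then have "matrix_exp (0 *\<^sub>R (0 :: real^'n^'n)) = mat 1"
    unfolding vec_eq_iff by (intro allI sums_unique2[OF matrix_exp_entry_sums])
  then show ?thesis by simp
qed

section \<open>Exponential decay for stable matrices\<close>

text \<open>The orbit starts at a complex vector because eigenvalues and the factors
  \<open>M - l\<close> are complex. One pair \<open>C\<close>, \<open>e\<close> serves all
  components; \<open>C\<close> is automatically nonnegative, as \<open>t = 0\<close> shows.\<close>

definition exp_decaying :: "real^'n^'n \<Rightarrow> complex^'n \<Rightarrow> bool" where
  "exp_decaying A v \<longleftrightarrow> (\<exists>C e. 0 < e \<and> (\<forall>t\<ge>0. \<forall>i.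
     cmod ((map_matrix complex_of_real (matrix_exp (t *\<^sub>R A)) *v v) $ i) \<le> C * exp (- e * t)))"

text \<open>Commutation lets \<open>A\<close> act on \<open>v\<close> first. The derivative is then
  again an orbit, now started at \<open>A v\<close>, so that orbits started at
  \<open>A v - l v\<close> can be brought in.\<close>

lemma complexified_exp_deriv:
  fixes A :: "real^'n^'n"
  shows "((\<lambda>t. (map_matrix complex_of_real (matrix_exp (t *\<^sub>R A)) *v v) $ i) has_vector_derivative
     (map_matrix complex_of_real (matrix_exp (t *\<^sub>R A)) *v (map_matrix complex_of_real A *v v)) $ i)
     (at t)"
proof -
  have *: "map_matrix complex_of_real X *v (map_matrix complex_of_real Y *v v)
      = map_matrix complex_of_real (X ** Y) *v v" for X Y :: "real^'n^'n"
    by (simp add: matrix_vector_mul_assoc, rule arg_cong[of _ _ "\<lambda>M. M *v v"])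
       (simp add: vec_eq_iff matrix_matrix_mult_def)
  have "((\<lambda>t. \<Sum>j\<in>UNIV. complex_of_real (matrix_exp (t *\<^sub>R A) $ i $ j) * v $ j) has_vector_derivative
     (\<Sum>j\<in>UNIV. complex_of_real ((A ** matrix_exp (t *\<^sub>R A)) $ i $ j) * v $ j)) (at t)"
    by (intro has_vector_derivative_sum has_vector_derivative_mult_left
        has_vector_derivative_of_real)
      (simp flip: has_real_derivative_iff_has_vector_derivative add: matrix_exp_entry_deriv)
  then show ?thesis
    unfolding * by (simp add: matrix_vector_mult_def matrix_exp_commute)
qed

text \<open>Variation of constants: \<open>exp (- l t) * exp (t A) v\<close> has derivative
  \<open>exp (- l t) * exp (t A) (A v - l v)\<close>. The decay hypothesis bounds this derivative,
  and multiplying back by \<open>exp (l t)\<close>, which decays, bounds the orbit of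
  \<open>v\<close>.\<close>

lemma exp_decaying_shift:
  fixes A :: "real^'n^'n"
  assumes w: "exp_decaying A (map_matrix complex_of_real A *v v - l *s v)" and l: "Re l < 0"
  shows "exp_decaying A v"
proof -
  let ?E = "\<lambda>t. map_matrix complex_of_real (matrix_exp (t *\<^sub>R A))"
  let ?w = "map_matrix complex_of_real A *v v - l *s v"
  obtain C e where e: "0 < e" and C: "\<And>t i. t \<ge> 0 \<Longrightarrow> cmod ((?E t *v ?w) $ i) \<le> C * exp (- e * t)"
    using w unfolding exp_decaying_def by blast
  have "0 \<le> C" using order_trans[OF norm_ge_zero C[of 0]] by simp
  \<comment> \<open>The rate is lowered to at most half of \<open>- Re l\<close>, so that
    \<open>a\<close> is positive and \<open>C / a * exp (a * s)\<close> is a primitive of the bound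
    even in the resonant case \<open>e = - Re l\<close>.\<close>
  define d where "d = min e (- Re l / 2)"
  define a where "a = - Re l - d"
  have d: "0 < d" "d \<le> e" "0 < a" "Re l \<le> - d" using e l by (auto simp: d_def a_def)
  have "cmod ((?E t *v v) $ i) \<le> (norm v + C / a) * exp (- d * t)" if "t \<ge> 0" for t i
  proof -
    let ?f = "\<lambda>t. exp (- l * of_real t) * (?E t *v v) $ i"
    have f': "(?f has_vector_derivative exp (- l * of_real s) * (?E s *v ?w) $ i) (at s)" for s
    proof -
      have "((\<lambda>s. exp (- l * of_real s)) has_vector_derivative exp (- l * of_real s) * (- l)) (at s)"
        by (rule has_vector_derivative_real_field) (auto intro!: derivative_eq_intros)
      from has_vector_derivative_mult[OF this complexified_exp_deriv[where A = A and v = v and t = s and i = i]]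
      show ?thesis
        by (simp add: matrix_vector_mult_diff_distrib algebra_simps vector_scalar_commute)
    qed
    \<comment> \<open>Mean value inequality: the norm of the derivative of \<open>?f\<close> is
      dominated by the derivative of the real function \<open>C / a * exp (a * s)\<close>. It needs
      a nondegenerate interval, so \<open>t = 0\<close> is treated apart.\<close>
    have bound: "cmod (?f t - ?f 0) \<le> C / a * exp (a * t) - C / a * exp (a * 0)" if "t > 0"
    proof (rule differentiable_bound_general[OF that])
      show "continuous_on {0..t} ?f"
        using f' has_vector_derivative_continuous continuous_at_imp_continuous_on by blast
      show "continuous_on {0..t} (\<lambda>s. C / a * exp (a * s))" by (intro continuous_intros)
      show "(?f has_vector_derivative exp (- l * of_real s) * (?E s *v ?w) $ i) (at s)" for s
        by (rule f')
      show "((\<lambda>s. C / a * exp (a * s)) has_vector_derivative C * exp (a * s)) (at s)" for s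
        unfolding has_real_derivative_iff_has_vector_derivative[symmetric] using d
        by (auto intro!: derivative_eq_intros)
      fix s :: real assume "0 < s"
      have "cmod (exp (- l * of_real s) * (?E s *v ?w) $ i) \<le> exp (- Re l * s) * (C * exp (- e * s))"
        unfolding norm_mult norm_exp_eq_Re using C[of s i] \<open>0 < s\<close> by (intro mult_mono) auto
      also have "\<dots> = C * exp (- Re l * s - e * s)" by (simp add: exp_diff exp_minus field_simps)
      also have "\<dots> \<le> C * exp (a * s)"
        using d \<open>0 \<le> C\<close> \<open>0 < s\<close> by (intro mult_left_mono) (auto simp: a_def algebra_simps)
      finally show "cmod (exp (- l * of_real s) * (?E s *v ?w) $ i) \<le> C * exp (a * s)" .
    qed
    have E0: "?E 0 *v v = v"
    proof -
      have "?E 0 = mat 1" by (simp add: matrix_exp_zero vec_eq_iff mat_def)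
      then show ?thesis by simp
    qed
    have "cmod (?f t - ?f 0) \<le> C / a * exp (a * t)"
      using bound \<open>0 \<le> C\<close> d \<open>t \<ge> 0\<close> by (cases "t = 0") (auto intro: order_trans)
    then have "cmod (?f t) \<le> norm v + C / a * exp (a * t)"
      using norm_triangle_ineq2[of "?f t" "?f 0"] Finite_Cartesian_Product.norm_nth_le[of v i]
      unfolding E0 by simp
    moreover have "cmod (?f t) = exp (- Re l * t) * cmod ((?E t *v v) $ i)"
      by (simp add: norm_mult norm_exp_eq_Re)
    ultimately have f: "exp (- Re l * t) * cmod ((?E t *v v) $ i) \<le> norm v + C / a * exp (a * t)"
      by simp
    have eq: "exp (Re l * t) * exp (- Re l * t) = 1" "exp (Re l * t) * exp (a * t) = exp (- d * t)"
      by (simp_all add: a_def left_diff_distrib flip: exp_add)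
    have "exp (Re l * t) * exp (- Re l * t) * cmod ((?E t *v v) $ i)
        \<le> exp (Re l * t) * (norm v + C / a * exp (a * t))"
      unfolding mult.assoc by (rule mult_left_mono[OF f]) simp
    then have "cmod ((?E t *v v) $ i) \<le> exp (Re l * t) * norm v + C / a * exp (- d * t)"
      unfolding eq distrib_left mult.left_commute[of _ "C / a"] by (simp only: mult_1_left)
    moreover have "Re l * t \<le> - d * t"
      using d(4) \<open>t \<ge> 0\<close> by (rule mult_right_mono)
    then have "exp (Re l * t) * norm v \<le> exp (- d * t) * norm v"
      by (intro mult_right_mono) simp_all
    ultimately show ?thesis by (simp only: distrib_right mult.commute[of "norm v"])
  qed
  then show ?thesis using d(1) unfolding exp_decaying_def by blast
qed

section \<open>Polynomials in a matrix that annihilate a vector\<close>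

text \<open>The vector \<open>p(M) v\<close>, formed from the iterates of a single vector, since
  \<open>matrix_power\<close> is restricted to real matrices.\<close>

definition poly_apply :: "complex^'n^'n \<Rightarrow> complex poly \<Rightarrow> complex^'n \<Rightarrow> complex^'n" where
  "poly_apply M p v = (\<Sum>k\<le>degree p. coeff p k *s (((*v) M ^^ k) v))"

lemma poly_apply_eq_sum:
  "degree p \<le> n \<Longrightarrow> poly_apply M p v = (\<Sum>k\<le>n. coeff p k *s (((*v) M ^^ k) v))"
  unfolding poly_apply_def by (rule sum.mono_neutral_left) (auto simp: coeff_eq_0)

text \<open>Here \<open>M - l\<close> acts first. If \<open>l\<close> is an eigenvalue, this passes
  from \<open>v\<close> to \<open>M v - l v\<close>, which the polynomial \<open>q\<close> of
  smaller degree annihilates.\<close>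

lemma poly_apply_linear_factor_right:
  "poly_apply M ([:- l, 1:] * q) v = poly_apply M q (M *v v - l *s v)"
proof -
  let ?x = "\<lambda>k. ((*v) M ^^ k) v"
  let ?n = "degree q"
  have pow: "((*v) M ^^ k) (M *v v - l *s v) = ?x (Suc k) - l *s ?x k" for k
    by (induction k) (simp_all add: matrix_vector_mult_diff_distrib vector_scalar_commute)
  have "poly_apply M ([:- l, 1:] * q) v = (\<Sum>k\<le>Suc ?n. coeff ([:- l, 1:] * q) k *s ?x k)"
    by (rule poly_apply_eq_sum) (use degree_mult_le[of "[:- l, 1:]" q] in simp)
  also have "\<dots> = (\<Sum>k\<le>Suc ?n. coeff (pCons 0 q) k *s ?x k) - (\<Sum>k\<le>Suc ?n. (l * coeff q k) *s ?x k)"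
    by (simp add: sum_subtractf[symmetric] vector_ssub_ldistrib algebra_simps del: sum.atMost_Suc)
  also have "(\<Sum>k\<le>Suc ?n. coeff (pCons 0 q) k *s ?x k) = (\<Sum>k\<le>?n. coeff q k *s ?x (Suc k))"
    by (subst sum.atMost_Suc_shift) simp
  also have "(\<Sum>k\<le>Suc ?n. (l * coeff q k) *s ?x k) = (\<Sum>k\<le>?n. coeff q k *s (l *s ?x k))"
    by (simp add: coeff_eq_0 vector_smult_assoc mult_ac)
  finally show ?thesis
    unfolding poly_apply_def pow by (simp add: sum_subtractf vector_ssub_ldistrib)
qed

text \<open>Here \<open>M - l\<close> acts last. If \<open>l\<close> is not an eigenvalue,
  \<open>M - l\<close> is injective and the factor can be cancelled, so that \<open>q\<close>
  already annihilates \<open>v\<close>.\<close>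

lemma poly_apply_linear_factor_left:
  "poly_apply M ([:- l, 1:] * q) v = M *v poly_apply M q v - l *s poly_apply M q v"
proof -
  have pow: "((*v) M ^^ k) (M *v v - l *s v) = M *v ((*v) M ^^ k) v - l *s ((*v) M ^^ k) v" for k
    by (induction k) (simp_all add: matrix_vector_mult_diff_distrib vector_scalar_commute)
  have sc: "c *s (l *s x) = l *s (c *s x)" for c and x :: "complex^'b"
    by (simp add: vector_smult_assoc mult_ac)
  show ?thesis
    unfolding poly_apply_linear_factor_right unfolding poly_apply_def pow
    by (simp add: sum_subtractf vector_ssub_ldistrib vec.linear_sum matrix_vector_mul_linear_gen
        vector_scalar_commute vec.scale_sum_right sc mult.commute)
qed

text \<open>More vectors than the dimension are dependent. Dependence is a property of sets, so a
  repetition \<open>x i = x j\<close> is a separate case, with coefficients \<open>1\<close> at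
  \<open>i\<close> and \<open>-1\<close> at \<open>j\<close>.\<close>

lemma finite_dim_sequence_relation:
  fixes x :: "nat \<Rightarrow> 'a::euclidean_space"
  obtains c :: "nat \<Rightarrow> real" and k where "k \<le> DIM('a)" "c k \<noteq> 0" "(\<Sum>k\<le>DIM('a). c k *\<^sub>R x k) = 0"
proof (cases "inj_on x {..DIM('a)}")
  case True
  have "dependent (x ` {..DIM('a)})"
    by (rule dependent_biggerset) (simp add: card_image[OF True])
  then obtain u k where "k \<le> DIM('a)" "u (x k) \<noteq> 0" "(\<Sum>v\<in>x ` {..DIM('a)}. u v *\<^sub>R v) = 0"
    by (auto simp: dependent_finite)
  then show ?thesis
    using that[of k "u \<circ> x"] by (simp add: sum.reindex[OF True])
next
  case False
  then obtain i j where ij: "i \<le> DIM('a)" "j \<le> DIM('a)" "i \<noteq> j" "x i = x j"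
    by (auto simp: inj_on_def)
  have "(\<Sum>k\<le>DIM('a). ((if k = i then 1 else 0) - (if k = j then 1 else 0)) *\<^sub>R x k) = x i - x j"
    using ij by (simp add: scaleR_left_diff_distrib sum_subtractf if_distrib[of "\<lambda>c. c *\<^sub>R _"] cong: if_cong)
  then show ?thesis
    using that[of i "\<lambda>k. (if k = i then 1 else 0) - (if k = j then 1 else 0)"] ij by simp
qed

text \<open>Induction on the degree, splitting off a root \<open>l\<close>. Stability gives
  \<open>Re l < 0\<close> when \<open>l\<close> is an eigenvalue, and
  \<open>exp_decaying_shift\<close> lifts decay from \<open>M v - l v\<close> to \<open>v\<close>;
  otherwise the factor cancels. A nonzero constant annihilates only \<open>v = 0\<close>.\<close>

lemma exp_decaying_if_annihilated:
  fixes A :: "real^'n^'n"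
  assumes A: "stable_matrix A" and "p \<noteq> 0" "poly_apply (map_matrix complex_of_real A) p v = 0"
  shows "exp_decaying A v"
  using assms(2,3)
proof (induction "degree p" arbitrary: p v rule: less_induct)
  case less
  let ?M = "map_matrix complex_of_real A"
  show ?case
  proof (cases "degree p = 0")
    case True
    then have "v = 0" using less.prems
      by (auto simp: poly_apply_def vector_mul_eq_0 leading_coeff_0_iff[symmetric] simp del: leading_coeff_0_iff)
    then show ?thesis unfolding exp_decaying_def by (auto intro!: exI[of _ 0] exI[of _ 1])
  next
    case False
    then obtain l where "poly p l = 0"
      using fundamental_theorem_of_algebra[of p] constant_degree[of p] by auto
    then obtain q where p: "p = [:- l, 1:] * q" by (auto simp: poly_eq_0_iff_dvd)
    with less.prems have "q \<noteq> 0" by auto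
    then have "degree p = degree [:- l, 1:] + degree q"
      unfolding p by (intro degree_mult_eq) auto
    then have "degree q < degree p" by simp
    note IH = less.hyps[OF this \<open>q \<noteq> 0\<close>]
    show ?thesis
    proof (cases "eigenvalue ?M l")
      case True
      then have "Re l < 0" using A by (simp add: stable_matrix_def)
      moreover have "poly_apply ?M q (?M *v v - l *s v) = 0"
        using less.prems(2) unfolding p by (simp only: poly_apply_linear_factor_right)
      ultimately show ?thesis using IH exp_decaying_shift by blast
    next
      case False
      have "?M *v poly_apply ?M q v = l *s poly_apply ?M q v"
        using less.prems(2) unfolding p poly_apply_linear_factor_left by simp
      then have "poly_apply ?M q v = 0" using False unfolding eigenvalue_def by blast
      then show ?thesis by (rule IH)
    qed
  qed
qed

text \<open>The first \<open>DIM(complex^'n) + 1\<close> iterates of \<open>v\<close> satisfy a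
  nontrivial real linear relation, whose coefficients form an annihilating polynomial.\<close>

lemma stable_exp_decaying:
  fixes A :: "real^'n^'n"
  assumes "stable_matrix A"
  shows "exp_decaying A v"
proof -
  let ?M = "map_matrix complex_of_real A"
  let ?N = "DIM(complex^'n)"
  obtain c k where c: "k \<le> ?N" "c k \<noteq> 0" "(\<Sum>k\<le>?N. c k *\<^sub>R (((*v) ?M ^^ k) v)) = 0"
    by (rule finite_dim_sequence_relation)
  define p where "p = (\<Sum>k\<le>?N. monom (complex_of_real (c k)) k)"
  have coeff: "coeff p k = (if k \<le> ?N then of_real (c k) else 0)" for k
    unfolding p_def by (simp add: coeff_sum)
  have "poly_apply ?M p v = (\<Sum>k\<le>?N. coeff p k *s (((*v) ?M ^^ k) v))"
    by (rule poly_apply_eq_sum) (rule degree_le, auto simp: coeff)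
  also have "\<dots> = (\<Sum>k\<le>?N. c k *\<^sub>R (((*v) ?M ^^ k) v))"
    by (rule sum.cong) (simp_all add: coeff vec_eq_iff scaleR_conv_of_real[where 'a=complex])
  finally have "poly_apply ?M p v = 0" using c by simp
  moreover have "p \<noteq> 0" using c coeff[of k] by auto
  ultimately show ?thesis using assms exp_decaying_if_annihilated by blast
qed

section \<open>Entrywise decay and integrability of the matrix exponential\<close>

text \<open>Column \<open>j\<close> of the exponential is the orbit of the basis vector
  \<open>axis j 1\<close>, so its constants are uniform in the row index.\<close>

lemma matrix_exp_entry_decay:
  fixes A :: "real^'n^'n"
  assumes "stable_matrix A"
  obtains C e where "0 < e" "0 \<le> C" "\<And>t i. t \<ge> 0 \<Longrightarrow> \<bar>matrix_exp (t *\<^sub>R A) $ i $ j\<bar> \<le> C * exp (- e * t)"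
proof -
  have "(map_matrix complex_of_real (matrix_exp (t *\<^sub>R A)) *v axis j 1) $ i
      = of_real (matrix_exp (t *\<^sub>R A) $ i $ j)" for t i
    by (simp add: matrix_vector_mult_def axis_def if_distrib cong: if_cong)
  then obtain C e where Ce: "0 < e" "\<And>t i. t \<ge> 0 \<Longrightarrow> \<bar>matrix_exp (t *\<^sub>R A) $ i $ j\<bar> \<le> C * exp (- e * t)"
    using stable_exp_decaying[OF assms, of "axis j 1"] unfolding exp_decaying_def
    by (metis norm_of_real)
  moreover have "0 \<le> C" using order_trans[OF abs_ge_zero Ce(2)[of 0]] by simp
  ultimately show ?thesis using that by blast
qed

lemma matrix_exp_entry_continuous: "continuous_on S (\<lambda>t. matrix_exp (t *\<^sub>R A) $ i $ j)"
  by (intro continuous_at_imp_continuous_on ballI DERIV_isCont[OF matrix_exp_entry_deriv])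

lemma matrix_exp_entry_tendsto_0:
  assumes "stable_matrix A"
  shows "((\<lambda>t. matrix_exp (t *\<^sub>R A) $ i $ j) \<longlongrightarrow> 0) at_top"
proof -
  obtain C e where Ce: "0 < e" "0 \<le> C" "\<And>t i. t \<ge> 0 \<Longrightarrow> \<bar>matrix_exp (t *\<^sub>R A) $ i $ j\<bar> \<le> C * exp (- e * t)"
    by (rule matrix_exp_entry_decay[OF assms, where j = j]) blast
  show ?thesis
  proof (rule Lim_null_comparison)
    show "\<forall>\<^sub>F t in at_top. norm (matrix_exp (t *\<^sub>R A) $ i $ j) \<le> C * exp (- e * t)"
      using eventually_ge_at_top[of 0] by eventually_elim (use Ce(3) in simp)
    show "((\<lambda>t. C * exp (- e * t)) \<longlongrightarrow> 0) at_top"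
      using Ce(1) by real_asymp
  qed
qed

lemma exp_products_integrable:
  assumes "stable_matrix A"
  shows "(\<lambda>t. matrix_exp (t *\<^sub>R A) $ k $ i * matrix_exp (t *\<^sub>R A) $ l $ j) absolutely_integrable_on {0..}"
proof -
  obtain C e where C: "0 < e" "0 \<le> C" "\<And>t k. t \<ge> 0 \<Longrightarrow> \<bar>matrix_exp (t *\<^sub>R A) $ k $ i\<bar> \<le> C * exp (- e * t)"
    by (rule matrix_exp_entry_decay[OF assms, where j = i]) blast
  obtain D d where D: "0 < d" "0 \<le> D" "\<And>t k. t \<ge> 0 \<Longrightarrow> \<bar>matrix_exp (t *\<^sub>R A) $ k $ j\<bar> \<le> D * exp (- d * t)"
    by (rule matrix_exp_entry_decay[OF assms, where j = j]) blast
  show ?thesis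
  proof (rule measurable_bounded_by_integrable_imp_absolutely_integrable)
    show "(\<lambda>t. matrix_exp (t *\<^sub>R A) $ k $ i * matrix_exp (t *\<^sub>R A) $ l $ j) \<in> borel_measurable (lebesgue_on {0..})"
      by (intro continuous_imp_measurable_on_sets_lebesgue continuous_intros matrix_exp_entry_continuous) auto
    show "(\<lambda>t. (C * D) * exp (- (e + d) * t)) integrable_on {0..}"
      using integrable_on_exp_minus_to_infinity[of "e + d" 0] C(1) D(1)
      by (intro integrable_on_mult_right) simp_all
    fix t :: real assume "t \<in> {0..}"
    then have "\<bar>matrix_exp (t *\<^sub>R A) $ k $ i\<bar> * \<bar>matrix_exp (t *\<^sub>R A) $ l $ j\<bar> \<le> (C * exp (- e * t)) * (D * exp (- d * t))"
      using C D by (intro mult_mono) auto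
    then show "norm (matrix_exp (t *\<^sub>R A) $ k $ i * matrix_exp (t *\<^sub>R A) $ l $ j) \<le> (C * D) * exp (- (e + d) * t)"
      by (simp add: abs_mult algebra_simps flip: exp_add)
  qed simp
qed

section \<open>Gramians\<close>

text \<open>A matrix is a finite combination of the unit matrices \<open>axis k (axis l 1)\<close>
  with scalar coefficients, and the integral commutes with such combinations.\<close>

lemma integral_matrix:
  fixes f :: "'m::finite \<Rightarrow> 'n::finite \<Rightarrow> real \<Rightarrow> real"
  assumes "\<And>k l. f k l integrable_on S"
  shows "integral S (\<lambda>t. \<chi> k l. f k l t) = (\<chi> k l. integral S (f k l))"
proof -
  have expand: "(\<chi> k l. c k l) = (\<Sum>k\<in>UNIV. \<Sum>l\<in>UNIV. c k l *\<^sub>R axis k (axis l 1))"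
    for c :: "'m \<Rightarrow> 'n \<Rightarrow> real"
  proof -
    have "(\<Sum>k\<in>UNIV. \<Sum>l\<in>UNIV. c k l *\<^sub>R axis k (axis l 1)) $ a $ b = c a b" for a b
    proof -
      have "(c k l *\<^sub>R axis k (axis l 1)) $ a $ b = (if k = a then if l = b then c k l else 0 else 0)" for k l
        by (simp add: axis_def)
      then have "(\<Sum>k\<in>UNIV. \<Sum>l\<in>UNIV. c k l *\<^sub>R axis k (axis l 1)) $ a $ b
          = (\<Sum>k\<in>UNIV. \<Sum>l\<in>UNIV. if k = a then if l = b then c k l else 0 else 0)"
        by (simp only: sum_component)
      also have "\<dots> = (\<Sum>k\<in>UNIV. if k = a then c k b else 0)"
        by (intro sum.cong) simp_all
      finally show ?thesis by simp
    qed
    then show ?thesis by (simp add: vec_eq_iff)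
  qed
  show ?thesis
    unfolding expand
    by (intro integral_unique has_integral_sum has_integral_scaleR_left integrable_integral assms) auto
qed

text \<open>The product is the outer product of column \<open>i\<close> of \<open>M\<close> and row
  \<open>i\<close> of \<open>N\<close>. This turns the matrix integrand of \<open>gramian\<close>
  into products of two scalar entries.\<close>

lemma unit_outer_product_sandwich:
  fixes M N :: "real^'n^'n"
  shows "(M ** ((columnvector (axis i 1) :: real^1^'n) ** (rowvector (axis i 1) :: real^'n^1)) ** N) $ k $ l
    = M $ k $ i * N $ i $ l"
proof -
  have "M ** (columnvector (axis i 1) :: real^1^'n) = columnvector (column i M)"
    by (simp add: vec_eq_iff matrix_matrix_mult_def columnvector_def column_def axis_def if_distrib cong: if_cong)
  moreover have "(rowvector (axis i 1) :: real^'n^1) ** N = rowvector (row i N)"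
    by (simp add: vec_eq_iff matrix_matrix_mult_def rowvector_def row_def axis_def
        if_distrib[of "\<lambda>x. x * _"] cong: if_cong)
  ultimately have "M ** ((columnvector (axis i 1) :: real^1^'n) ** (rowvector (axis i 1) :: real^'n^1)) ** N
      = (columnvector (column i M) :: real^1^'n) ** (rowvector (row i N) :: real^'n^1)"
    by (metis matrix_mul_assoc)
  then show ?thesis
    by (simp add: matrix_matrix_mult_def columnvector_def rowvector_def column_def row_def)
qed

lemma gramian_eq:
  assumes "stable_matrix A"
  shows "gramian A i = (\<chi> k l. integral {0..} (\<lambda>t. matrix_exp (t *\<^sub>R A) $ k $ i * matrix_exp (t *\<^sub>R A) $ l $ i))"
proof -
  have "gramian A i = integral {0..} (\<lambda>t. \<chi> k l. matrix_exp (t *\<^sub>R A) $ k $ i * matrix_exp (t *\<^sub>R A) $ l $ i)"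
    unfolding gramian_def
    by (rule integral_cong) (simp add: vec_eq_iff unit_outer_product_sandwich matrix_exp_transpose, simp add: transpose_def)
  also have "\<dots> = (\<chi> k l. integral {0..} (\<lambda>t. matrix_exp (t *\<^sub>R A) $ k $ i * matrix_exp (t *\<^sub>R A) $ l $ i))"
    by (intro integral_matrix set_lebesgue_integral_eq_integral exp_products_integrable assms)
  finally show ?thesis .
qed

lemma W_con_entry:
  assumes "stable_matrix A"
  shows "W_con A p $ k $ l =
    (\<Sum>i\<in>UNIV. p $ i * integral {0..} (\<lambda>t. matrix_exp (t *\<^sub>R A) $ k $ i * matrix_exp (t *\<^sub>R A) $ l $ i))"
  by (simp add: W_con_def gramian_eq[OF assms] sum_component)

lemma transpose_W_con:
  assumes "stable_matrix A"
  shows "transpose (W_con A p) = W_con A p"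
  by (simp add: vec_eq_iff transpose_def W_con_entry[OF assms] mult.commute)

lemma W_con_quadratic: "x \<bullet> (W_con A p *v x) = (\<Sum>i\<in>UNIV. p $ i * (x \<bullet> (gramian A i *v x)))"
proof -
  have "W_con A p *v x = (\<Sum>i\<in>UNIV. (p $ i *\<^sub>R gramian A i) *v x)"
    unfolding W_con_def by (induction rule: infinite_finite_induct) (simp_all add: matrix_vector_mult_add_rdistrib)
  then show ?thesis by (simp add: scaleR_matrix_vector_assoc[symmetric] inner_sum_right)
qed

lemma W_con_midpoint: "W_con A ((1/2) *\<^sub>R (p + q)) = (1/2) *\<^sub>R (W_con A p + W_con A q)"
  unfolding W_con_def by (simp add: scaleR_sum_right sum.distrib[symmetric] algebra_simps add_divide_distrib)

text \<open>The integrand is the square of component \<open>i\<close> of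
  \<open>exp (t A)\<^sup>T x\<close>, which makes the sign of the quadratic form visible.\<close>

lemma gramian_quadratic:
  assumes "stable_matrix A"
  shows "((\<lambda>t. (\<Sum>k\<in>UNIV. x $ k * matrix_exp (t *\<^sub>R A) $ k $ i)\<^sup>2) has_integral x \<bullet> (gramian A i *v x)) {0..}"
proof -
  let ?E = "\<lambda>t. matrix_exp (t *\<^sub>R A)"
  have "((\<lambda>t. \<Sum>k\<in>UNIV. \<Sum>l\<in>UNIV. (x $ k * x $ l) *\<^sub>R (?E t $ k $ i * ?E t $ l $ i)) has_integral
      (\<Sum>k\<in>UNIV. \<Sum>l\<in>UNIV. (x $ k * x $ l) *\<^sub>R integral {0..} (\<lambda>t. ?E t $ k $ i * ?E t $ l $ i))) {0..}"
    by (intro has_integral_sum has_integral_cmul integrable_integral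
        set_lebesgue_integral_eq_integral exp_products_integrable assms) auto
  moreover have "(\<Sum>k\<in>UNIV. \<Sum>l\<in>UNIV. (x $ k * x $ l) *\<^sub>R (?E t $ k $ i * ?E t $ l $ i))
      = (\<Sum>k\<in>UNIV. x $ k * ?E t $ k $ i)\<^sup>2" for t
    by (simp add: power2_eq_square sum_product mult_ac)
  moreover have "(\<Sum>k\<in>UNIV. \<Sum>l\<in>UNIV. (x $ k * x $ l) *\<^sub>R integral {0..} (\<lambda>t. ?E t $ k $ i * ?E t $ l $ i))
      = x \<bullet> (gramian A i *v x)"
    by (simp add: gramian_eq[OF assms] inner_vec_def matrix_vector_mult_def sum_distrib_left mult_ac)
  ultimately show ?thesis by simp
qed

lemma gramian_quadratic_nonneg:
  assumes "stable_matrix A"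
  shows "0 \<le> x \<bullet> (gramian A i *v x)"
  using gramian_quadratic[OF assms] by (rule has_integral_nonneg) simp

text \<open>At \<open>t = 0\<close> the integrand equals \<open>(x $ i)\<^sup>2\<close>, which is
  positive; by continuity the integral over \<open>{0..1}\<close> is already positive.\<close>

lemma gramian_quadratic_pos:
  assumes "stable_matrix A" and "x $ i \<noteq> 0"
  shows "0 < x \<bullet> (gramian A i *v x)"
proof -
  let ?h = "\<lambda>t. (\<Sum>k\<in>UNIV. x $ k * matrix_exp (t *\<^sub>R A) $ k $ i)\<^sup>2"
  note int = gramian_quadratic[OF assms(1), of x i]
  have cont: "continuous_on S ?h" for S
    by (intro continuous_intros matrix_exp_entry_continuous)
  have "?h 0 = (x $ i)\<^sup>2"
    by (simp add: matrix_exp_zero mat_def if_distrib cong: if_cong)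
  then have "integral {0..1} ?h \<noteq> 0"
    using integral_eq_0_iff[OF cont, of 0 1] assms(2) by force
  then have "0 < integral {0..1} ?h"
    using integral_nonneg[OF integrable_continuous_interval[OF cont], of 0 1] by force
  also have "\<dots> \<le> integral {0..} ?h"
    using int by (intro integral_subset_le integrable_continuous_interval cont) auto
  finally show ?thesis using int by (simp add: integral_unique)
qed

text \<open>All weights are positive, so any nonzero component of \<open>x\<close> contributes a
  positive term. The feasible set is therefore nonempty and the infimum of the objective over it is
  meaningful.\<close>

lemma uniform_feasible:
  fixes A :: "real^'n^'n"
  assumes "stable_matrix A"
  shows "(\<chi> i. 1 / real CARD('n)) \<in> feasible A"
proof -
  have "0 < x \<bullet> (W_con A (\<chi> i. 1 / real CARD('n)) *v x)" if x: "x \<noteq> 0" for x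
  proof -
    obtain i where "x $ i \<noteq> 0" using x by (auto simp: vec_eq_iff)
    then show ?thesis
      unfolding W_con_quadratic
      by (intro sum_pos2[of _ i]) (simp_all add: gramian_quadratic_pos gramian_quadratic_nonneg assms)
  qed
  then show ?thesis
    by (simp add: feasible_def pd_region_def pos_def_matrix_def transpose_W_con[OF assms] prob_simplex_def)
qed

section \<open>Lyapunov equation and injectivity of \<open>W_con A\<close>\<close>

text \<open>The fundamental theorem holds on each \<open>{0..real n}\<close>; dominated convergence,
  with the absolute value of \<open>f'\<close> as majorant, carries it to the half-line.\<close>

lemma improper_FTC:
  fixes f f' :: "real \<Rightarrow> real"
  assumes deriv: "\<And>t. (f has_real_derivative f' t) (at t)"
    and int: "f' absolutely_integrable_on {0..}" and lim: "(f \<longlongrightarrow> L) at_top"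
  shows "integral {0..} f' = L - f 0"
proof -
  let ?g = "\<lambda>n t. if t \<in> {0..real n} then f' t else 0"
  have FTC: "(f' has_integral f (real n) - f 0) {0..real n}" for n
    using deriv by (intro fundamental_theorem_of_calculus)
      (auto simp: has_real_derivative_iff_has_vector_derivative has_vector_derivative_at_within)
  have "(\<lambda>n. integral {0..} (?g n)) \<longlonglongrightarrow> integral {0..} f'"
  proof (rule dominated_convergence)
    show "?g n integrable_on {0..}" for n
      using FTC[of n] unfolding integrable_restrict_Int by (auto simp: Int_absorb2)
    show "(\<lambda>t. norm (f' t)) integrable_on {0..}"
      using int by (simp add: absolutely_integrable_on_def)
    show "norm (?g n t) \<le> norm (f' t)" for n t by simp
    show "(\<lambda>n. ?g n t) \<longlonglongrightarrow> f' t" if "t \<in> {0..}" for t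
    proof (rule tendsto_eventually)
      show "\<forall>\<^sub>F n in sequentially. ?g n t = f' t"
        using eventually_ge_at_top[of "nat \<lceil>t\<rceil>"] by eventually_elim (use that in \<open>auto simp: nat_le_iff ceiling_le_iff\<close>)
    qed
  qed
  moreover have "integral {0..} (?g n) = f (real n) - f 0" for n
    using integral_unique[OF FTC[of n]] unfolding integral_restrict_Int by (simp add: Int_absorb2)
  moreover have "(\<lambda>n. f (real n) - f 0) \<longlonglongrightarrow> L - f 0"
    by (intro tendsto_intros filterlim_compose[OF lim filterlim_real_sequentially])
  ultimately show ?thesis using LIMSEQ_unique by simp
qed

text \<open>The diagonal of the Lyapunov equation \<open>A W + W A\<^sup>T = - diag p\<close>.\<close>

lemma W_con_lyapunov_diagonal:
  fixes A :: "real^'n^'n"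
  assumes "stable_matrix A"
  shows "2 * (A ** W_con A p) $ k $ k = - p $ k"
proof -
  let ?E = "\<lambda>t. matrix_exp (t *\<^sub>R A)"
  \<comment> \<open>This is the diagonal entry \<open>k\<close> of
    \<open>exp (t A) diag p exp (t A)\<^sup>T\<close>. On the diagonal the two terms of its
    derivative coincide, whence the factor 2.\<close>
  let ?f = "\<lambda>t. \<Sum>i\<in>UNIV. p $ i * (?E t $ k $ i)\<^sup>2"
  let ?f' = "\<lambda>t. \<Sum>i\<in>UNIV. \<Sum>m\<in>UNIV. (2 * p $ i * A $ k $ m) *\<^sub>R (?E t $ m $ i * ?E t $ k $ i)"
  have "integral {0..} ?f' = 0 - ?f 0"
  proof (rule improper_FTC)
    have "(?f has_real_derivative (\<Sum>i\<in>UNIV. p $ i * (2 * (A ** ?E t) $ k $ i * ?E t $ k $ i))) (at t)" for t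
      by (rule DERIV_sum) (auto intro!: derivative_eq_intros matrix_exp_entry_deriv)
    moreover have "(\<Sum>i\<in>UNIV. p $ i * (2 * (A ** ?E t) $ k $ i * ?E t $ k $ i)) = ?f' t" for t
      by (simp add: matrix_matrix_mult_def sum_distrib_left sum_distrib_right mult_ac)
    ultimately show "(?f has_real_derivative ?f' t) (at t)" for t by simp
    show "?f' absolutely_integrable_on {0..}"
      by (intro absolutely_integrable_sum absolutely_integrable_scaleR_left exp_products_integrable assms) auto
    show "(?f \<longlongrightarrow> 0) at_top"
    proof -
      have "(?f \<longlongrightarrow> (\<Sum>i\<in>UNIV. p $ i * 0\<^sup>2)) at_top"
        by (intro tendsto_sum tendsto_mult_left tendsto_power matrix_exp_entry_tendsto_0 assms)
      then show ?thesis by simp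
    qed
  qed
  also have "?f 0 = p $ k"
    by (simp add: matrix_exp_zero mat_def if_distrib[of "\<lambda>x. x\<^sup>2"] if_distrib[of "\<lambda>x. _ * x"] cong: if_cong)
  also have "integral {0..} ?f' = (\<Sum>i\<in>UNIV. \<Sum>m\<in>UNIV. (2 * p $ i * A $ k $ m) *\<^sub>R integral {0..} (\<lambda>t. ?E t $ m $ i * ?E t $ k $ i))"
    by (intro integral_unique has_integral_sum has_integral_cmul integrable_integral
        set_lebesgue_integral_eq_integral exp_products_integrable assms) auto
  also have "\<dots> = 2 * (A ** W_con A p) $ k $ k"
    by (subst sum.swap) (simp add: matrix_matrix_mult_def W_con_entry[OF assms] sum_distrib_left mult_ac)
  finally show ?thesis by simp
qed

text \<open>The Lyapunov diagonal reads \<open>p\<close> off from \<open>W_con A p\<close>. Strict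
  convexity in the matrix thereby becomes strict convexity in \<open>p\<close>.\<close>

lemma W_con_inj:
  assumes "stable_matrix A" "W_con A p = W_con A q"
  shows "p = q"
  using W_con_lyapunov_diagonal[OF assms(1), of p] W_con_lyapunov_diagonal[OF assms(1), of q] assms(2)
  by (simp add: vec_eq_iff)

section \<open>The trace of the inverse as a maximum of affine functionals\<close>

lemma pos_def_inverse:
  assumes "pos_def_matrix W"
  shows "W ** matrix_inv W = mat 1" "matrix_inv W ** W = mat 1"
proof -
  have "\<forall>x. W *v x = 0 \<longrightarrow> x = 0"
    using assms unfolding pos_def_matrix_def by (metis inner_zero_right less_irrefl)
  then have "invertible W" by (simp add: invertible_left_inverse matrix_left_invertible_ker)
  then have "\<exists>B. W ** B = mat 1 \<and> B ** W = mat 1" unfolding invertible_def .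
  then have "W ** matrix_inv W = mat 1 \<and> matrix_inv W ** W = mat 1"
    unfolding matrix_inv_def by (rule someI_ex)
  then show "W ** matrix_inv W = mat 1" "matrix_inv W ** W = mat 1" by auto
qed

text \<open>With the \<open>Y j\<close> as columns of a matrix \<open>Y\<close>, this is
  \<open>2 tr Y - tr (Y\<^sup>T W Y)\<close>. It contains no inverse, so it makes sense for singular
  \<open>W\<close> too.\<close>

definition inv_trace_dual :: "real^'n^'n \<Rightarrow> ('n \<Rightarrow> real^'n) \<Rightarrow> real" where
  "inv_trace_dual W Y = (\<Sum>j\<in>UNIV. 2 * Y j $ j - Y j \<bullet> (W *v Y j))"

text \<open>Completing the square around \<open>z j\<close>, the column \<open>j\<close> of the
  inverse, which satisfies \<open>W *v z j = axis j 1\<close>.\<close>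

lemma inv_trace_dual_gap:
  fixes W :: "real^'n^'n"
  assumes "pos_def_matrix W"
  defines "z \<equiv> \<lambda>j. matrix_inv W *v axis j 1"
  shows "trace (matrix_inv W) - inv_trace_dual W Y = (\<Sum>j\<in>UNIV. (Y j - z j) \<bullet> (W *v (Y j - z j)))"
proof -
  have "2 * Y j $ j - Y j \<bullet> (W *v Y j) = matrix_inv W $ j $ j - (Y j - z j) \<bullet> (W *v (Y j - z j))" for j
  proof -
    have Wz: "W *v z j = axis j 1"
      unfolding z_def by (simp add: matrix_vector_mul_assoc pos_def_inverse[OF assms(1)])
    have "z j \<bullet> (W *v Y j) = (W *v z j) \<bullet> Y j"
      using assms(1) unfolding pos_def_matrix_def by (metis dot_lmul_matrix vector_transpose_matrix)
    moreover have "z j $ j = matrix_inv W $ j $ j"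
      by (simp add: z_def matrix_vector_mult_basis column_def)
    ultimately show ?thesis
      by (simp add: matrix_vector_mult_diff_distrib inner_diff_left inner_diff_right Wz inner_axis inner_axis')
  qed
  then show ?thesis by (simp add: inv_trace_dual_def trace_def sum_subtractf)
qed

lemma inv_trace_dual_le:
  assumes "pos_def_matrix W"
  shows "inv_trace_dual W Y \<le> trace (matrix_inv W)"
proof -
  have "0 \<le> x \<bullet> (W *v x)" for x
    using assms unfolding pos_def_matrix_def by (cases "x = 0") (auto intro: less_imp_le)
  then have "0 \<le> trace (matrix_inv W) - inv_trace_dual W Y"
    unfolding inv_trace_dual_gap[OF assms] by (intro sum_nonneg) auto
  then show ?thesis by simp
qed

text \<open>By definiteness the gap vanishes only if every \<open>Y j - z j\<close> does. The
  maximizer is thus unique and consists of the columns of the inverse.\<close>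

lemma inv_trace_dual_eq_iff:
  assumes "pos_def_matrix W"
  shows "inv_trace_dual W Y = trace (matrix_inv W) \<longleftrightarrow> (\<forall>j. Y j = matrix_inv W *v axis j 1)"
proof -
  let ?z = "\<lambda>j. matrix_inv W *v axis j 1"
  have nn: "0 \<le> x \<bullet> (W *v x)" "x \<bullet> (W *v x) = 0 \<longleftrightarrow> x = 0" for x
    using assms unfolding pos_def_matrix_def by (cases "x = 0"; force intro: less_imp_le)+
  have "inv_trace_dual W Y = trace (matrix_inv W) \<longleftrightarrow> trace (matrix_inv W) - inv_trace_dual W Y = 0"
    by auto
  also have "\<dots> \<longleftrightarrow> (\<forall>j. Y j = ?z j)"
    unfolding inv_trace_dual_gap[OF assms] by (subst sum_nonneg_eq_0_iff) (auto simp: nn)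
  finally show ?thesis .
qed

lemma pos_def_midpoint:
  assumes "pos_def_matrix W" "pos_def_matrix V"
  shows "pos_def_matrix ((1/2) *\<^sub>R (W + V))"
proof -
  have "0 < x \<bullet> (((1/2) *\<^sub>R (W + V)) *v x)" if "x \<noteq> 0" for x
    using assms that add_pos_pos[of "x \<bullet> (W *v x)" "x \<bullet> (V *v x)"] unfolding pos_def_matrix_def
    by (simp add: scaleR_matrix_vector_assoc[symmetric] matrix_vector_mult_add_rdistrib inner_add_right)
  moreover have "transpose ((1/2) *\<^sub>R (W + V)) = (1/2) *\<^sub>R (W + V)"
    using assms unfolding pos_def_matrix_def by (simp add: transpose_def vec_eq_iff)
  ultimately show ?thesis unfolding pos_def_matrix_def by blast
qed

text \<open>The maximizer \<open>Y\<close> for the midpoint \<open>U\<close> is tested against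
  \<open>W\<close> and \<open>V\<close>. Since the functional is affine in the matrix, equality
  would make \<open>Y\<close> optimal for both, so that \<open>W\<close>, \<open>V\<close> and
  \<open>U\<close> would share one inverse.\<close>

lemma trace_inverse_midpoint_less:
  assumes W: "pos_def_matrix W" and V: "pos_def_matrix V" and "W \<noteq> V"
  shows "trace (matrix_inv ((1/2) *\<^sub>R (W + V))) < (trace (matrix_inv W) + trace (matrix_inv V)) / 2"
proof -
  define U where "U = (1/2) *\<^sub>R (W + V)"
  define Y where "Y = (\<lambda>j. matrix_inv U *v axis j 1)"
  have U: "pos_def_matrix U" unfolding U_def using W V by (rule pos_def_midpoint)
  have "inv_trace_dual U Y = (inv_trace_dual W Y + inv_trace_dual V Y) / 2"
    unfolding inv_trace_dual_def U_def
    by (simp add: scaleR_matrix_vector_assoc[symmetric] matrix_vector_mult_add_rdistrib inner_add_right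
        sum.distrib[symmetric] sum_divide_distrib) (simp add: field_simps)
  moreover have "inv_trace_dual U Y = trace (matrix_inv U)"
    using U by (simp add: inv_trace_dual_eq_iff Y_def)
  moreover have "inv_trace_dual W Y < trace (matrix_inv W) \<or> inv_trace_dual V Y < trace (matrix_inv V)"
  proof (rule ccontr)
    have inverse_eqD: "U = X" if X: "pos_def_matrix X" and "\<not> inv_trace_dual X Y < trace (matrix_inv X)" for X
    proof -
      have "inv_trace_dual X Y = trace (matrix_inv X)"
        using that inv_trace_dual_le[OF X, of Y] by simp
      then have "column j (matrix_inv U) = column j (matrix_inv X)" for j
        unfolding inv_trace_dual_eq_iff[OF X] Y_def by (simp add: matrix_vector_mult_basis)
      then have "matrix_inv U = matrix_inv X" by (simp add: vec_eq_iff column_def)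
      then show "U = X"
        using pos_def_inverse[OF U] pos_def_inverse[OF X] by (metis matrix_mul_assoc matrix_mul_lid matrix_mul_rid)
    qed
    assume "\<not> ?thesis"
    then show False using inverse_eqD[OF W] inverse_eqD[OF V] \<open>W \<noteq> V\<close> by simp
  qed
  ultimately show ?thesis
    using inv_trace_dual_le[OF W, of Y] inv_trace_dual_le[OF V, of Y] unfolding U_def by auto
qed

text \<open>If \<open>x \<bullet> W x \<le> 0\<close> and \<open>x\<^sub>j \<noteq> 0\<close>, then putting a large multiple of \<open>x\<close> in slot \<open>j\<close>
  makes the dual functional unbounded.\<close>

lemma pos_def_if_inv_trace_dual_bounded:
  fixes W :: "real^'n^'n"
  assumes "transpose W = W" and bound: "\<And>Y. inv_trace_dual W Y \<le> c"
  shows "pos_def_matrix W"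
proof -
  have "0 < x \<bullet> (W *v x)" if "x \<noteq> 0" for x
  proof (rule ccontr)
    assume "\<not> 0 < x \<bullet> (W *v x)"
    obtain j where j: "x $ j \<noteq> 0" using \<open>x \<noteq> 0\<close> by (auto simp: vec_eq_iff)
    \<comment> \<open>Chosen so that the linear term \<open>2 * s * x $ j\<close> equals
      \<open>\<bar>c\<bar> + 1\<close>, which exceeds \<open>c\<close>, whatever the sign of
      \<open>x $ j\<close>.\<close>
    define s where "s = (\<bar>c\<bar> + 1) / (2 * x $ j)"
    define Y where "Y = (\<lambda>i. if i = j then s *\<^sub>R x else 0)"
    have "inv_trace_dual W Y = (\<Sum>i\<in>UNIV. if i = j then 2 * s * x $ j - s\<^sup>2 * (x \<bullet> (W *v x)) else 0)"
      unfolding inv_trace_dual_def Y_def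
      by (intro sum.cong) (auto simp: matrix_vector_mult_scaleR power2_eq_square)
    also have "\<dots> = \<bar>c\<bar> + 1 - s\<^sup>2 * (x \<bullet> (W *v x))"
      using j by (simp add: s_def)
    finally have "\<bar>c\<bar> + 1 - s\<^sup>2 * (x \<bullet> (W *v x)) \<le> c" using bound[of Y] by simp
    moreover have "s\<^sup>2 * (x \<bullet> (W *v x)) \<le> 0"
      using \<open>\<not> 0 < x \<bullet> (W *v x)\<close> by (intro mult_nonneg_nonpos) auto
    ultimately show False by simp
  qed
  then show ?thesis using assms(1) unfolding pos_def_matrix_def by blast
qed

section \<open>Existence and uniqueness of the minimizer\<close>

lemma compact_prob_simplex: "compact (prob_simplex :: (real^'n) set)"
unfolding compact_eq_bounded_closed
proof
  show "closed (prob_simplex :: (real^'n) set)"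
    unfolding prob_simplex_def
    by (intro closed_Collect_conj closed_Collect_eq closed_Collect_all closed_Collect_le continuous_intros)
  have "norm p \<le> 1" if "p \<in> prob_simplex" for p :: "real^'n"
    using norm_le_l1_cart[of p] that by (simp add: prob_simplex_def)
  then show "bounded (prob_simplex :: (real^'n) set)" unfolding bounded_iff by blast
qed

lemma feasible_iff:
  "p \<in> feasible A \<longleftrightarrow> pos_def_matrix (W_con A p) \<and> p \<in> prob_simplex"
  by (simp add: feasible_def pd_region_def)

lemma feasible_midpoint:
  assumes "p \<in> feasible A" "q \<in> feasible A"
  shows "(1/2) *\<^sub>R (p + q) \<in> feasible A"
  using assms
  by (auto simp: feasible_iff W_con_midpoint pos_def_midpoint prob_simplex_def sum.distrib
      sum_divide_distrib[symmetric])

lemma objective_midpoint_less: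
  assumes "stable_matrix A" "p \<in> feasible A" "q \<in> feasible A" "p \<noteq> q"
  shows "objective A ((1/2) *\<^sub>R (p + q)) < (objective A p + objective A q) / 2"
  using assms W_con_inj[OF assms(1), of p q] trace_inverse_midpoint_less
  unfolding objective_def W_con_midpoint feasible_iff by blast

text \<open>A minimizing sequence has a subsequence converging in the compact simplex. The limit
  could a priori leave \<open>pd_region A\<close>; the bound \<open>m\<close> on all dual
  functionals passes to the limit and excludes this.\<close>

lemma minimizer_exists:
  fixes A :: "real^'n^'n"
  assumes A: "stable_matrix A"
  obtains p where "p \<in> feasible A" "\<And>q. q \<in> feasible A \<Longrightarrow> objective A p \<le> objective A q"
proof -
  define m where "m = Inf (objective A ` feasible A)"
  have dual_le: "inv_trace_dual (W_con A q) Y \<le> objective A q" if "q \<in> feasible A" for q Y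
    using that inv_trace_dual_le by (auto simp: feasible_iff objective_def)
  \<comment> \<open>The zero family has dual value 0.\<close>
  have "0 \<le> objective A q" if "q \<in> feasible A" for q
    using dual_le[OF that, of "\<lambda>_. 0"] by (simp add: inv_trace_dual_def)
  then have bdd: "bdd_below (objective A ` feasible A)" by (auto intro!: bdd_belowI[of _ 0])
  have "objective A ` feasible A \<noteq> {}" using uniform_feasible[OF A] by blast
  then have "\<exists>q. q \<in> feasible A \<and> objective A q < m + inverse (real (Suc n))" for n
    using cInf_lessD[of "objective A ` feasible A" "m + inverse (real (Suc n))"] unfolding m_def by fastforce
  then obtain P where P: "\<And>n. P n \<in> feasible A" "\<And>n. objective A (P n) < m + inverse (real (Suc n))"
    by metis
  then have "\<forall>n. P n \<in> prob_simplex" by (simp add: feasible_iff)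
  then obtain p r where p: "p \<in> prob_simplex" "strict_mono r" "(P \<circ> r) \<longlonglongrightarrow> p"
    using compact_prob_simplex unfolding compact_def by metis
  \<comment> \<open>For fixed \<open>Y\<close> the functional is affine in the weights, hence
    continuous, and the limit can be taken before \<open>W_con A p\<close> is known to be
    invertible.\<close>
  have bound: "inv_trace_dual (W_con A p) Y \<le> m" for Y
  proof (rule LIMSEQ_le)
    show "(\<lambda>n. inv_trace_dual (W_con A ((P \<circ> r) n)) Y) \<longlonglongrightarrow> inv_trace_dual (W_con A p) Y"
      unfolding inv_trace_dual_def W_con_quadratic by (intro tendsto_intros p(3))
    show "(\<lambda>n. m + inverse (real (Suc (r n)))) \<longlonglongrightarrow> m"
      using LIMSEQ_subseq_LIMSEQ[OF LIMSEQ_inverse_real_of_nat_add p(2)] by (simp add: o_def)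
    show "\<exists>N. \<forall>n\<ge>N. inv_trace_dual (W_con A ((P \<circ> r) n)) Y \<le> m + inverse (real (Suc (r n)))"
      using order_trans[OF dual_le[OF P(1)] less_imp_le[OF P(2)]] by simp
  qed
  have pd: "pos_def_matrix (W_con A p)"
    using transpose_W_con[OF A] bound by (rule pos_def_if_inv_trace_dual_bounded)
  show ?thesis
  proof (rule that)
    show "p \<in> feasible A" using pd p by (simp add: feasible_iff)
    \<comment> \<open>Now that \<open>W_con A p\<close> is positive definite, the columns of its
      inverse attain the maximum, so the bound applies to the objective itself.\<close>
    have "objective A p \<le> m"
      using bound[of "\<lambda>j. matrix_inv (W_con A p) *v axis j 1"] inv_trace_dual_eq_iff[OF pd, THEN iffD2]
      by (simp add: objective_def)
    then show "objective A p \<le> objective A q" if "q \<in> feasible A" for q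
      unfolding m_def using cInf_lower[OF imageI[OF that] bdd] by simp
  qed
qed

theorem mainTheorem4:
  fixes A :: "real^'n^'n"
  assumes "stable_matrix A"
  shows "\<exists>!p. p \<in> feasible A \<and> (\<forall>q\<in>feasible A. objective A p \<le> objective A q)"
proof -
  obtain p where p: "p \<in> feasible A" "\<And>q. q \<in> feasible A \<Longrightarrow> objective A p \<le> objective A q"
    using minimizer_exists[OF assms] by blast
  show ?thesis
  proof (rule ex1I[of _ p])
    show "p \<in> feasible A \<and> (\<forall>q\<in>feasible A. objective A p \<le> objective A q)" using p by blast
  next
    fix q assume q: "q \<in> feasible A \<and> (\<forall>p\<in>feasible A. objective A q \<le> objective A p)"
    show "q = p"
    proof (rule ccontr)
      assume "q \<noteq> p"
      then have "objective A ((1/2) *\<^sub>R (q + p)) < (objective A q + objective A p) / 2"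
        using objective_midpoint_less assms p q by blast
      moreover have "objective A p \<le> objective A ((1/2) *\<^sub>R (q + p))"
        using feasible_midpoint p q by blast
      moreover have "objective A q \<le> objective A p" using p q by blast
      ultimately show False by simp
    qed
  qed
qed

end
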